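(* Let $t_1,t_2,t_3,t_4$ be nonzero complex numbers and $h_i,l_i,\tilde h_i,\tilde l_i$ ($i=1,2,3,4$), $\alpha,\tilde\alpha,\mu_0,\mu,\chi,\nu$ be complex parameters satisfying \begin{gather*} \chi = \big( \tilde{h}_1 + \tilde{h}_2 + \tilde{h}_3 + \tilde{h}_4 - \tilde{l}_1 - \tilde{l}_2 - \tilde{l}_3 - \tilde{l}_4 \big)/2 , \qquad \nu = 2 \mu _0 + \alpha - \tilde{\alpha } + \chi , \\ \mu = \mu _0 + \chi +1,\qquad l_i = \tilde{h}_i +\mu _0 , \qquad h_i = \tilde{l}_i +\mu _0 +\chi , \qquad i=1,2,3,4 . \end{gather*} Let $P_{\mu,\mu_0}(x,s)$ be a function satisfying \begin{gather*} P_{\mu ,\mu _0} (x,s/q)= P_{\mu ,\mu _0 } (qx,s) = \frac{x-q^{\mu -1 }s}{x-q^{\mu _0 -1} s} P_{\mu ,\mu _0 } (x,s), \\ P_{\mu ,\mu _0 } (x,qs)= P_{\mu ,\mu _0 } (x/q,s) = \frac{x-q^{\mu _0 } s}{x-q^{\mu }s} P_{\mu ,\mu _0 } (x,s) . \end{gather*} Then \begin{gather*} A^{\langle 2 \rangle} ( x; h_1, h_2, h_3, h_4, l_1, l_2, l_3, l_4 ,\alpha )\, x^{-\alpha } s^{\chi +1 - \tilde{\alpha }} P_{\mu ,\mu _0 } (x,s) \\ = q^{\nu } A^{\langle 2 \rangle} \big( s; \tilde{h}_1, \tilde{h}_2, \tilde{h}_3, \tilde{h}_4, \tilde{l}_1,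 \tilde{l}_2, \tilde{l}_3, \tilde{l}_4 , \tilde{\alpha } \big)\, x^{-\alpha } s^{\chi +1 - \tilde{\alpha }} P_{\mu ,\mu _0 } (x,s). \end{gather*}
   Context: $q$ is a complex number with $0<|q|<1$. Complex powers are taken with a fixed branch of $\log q$, so that $q^a=\exp(a\log q)$ and power functions obey $(q^{\pm1}x)^a=q^{\pm a}x^a$. Identities are understood at points where all expressions are defined. $T_x^{\pm1}$ is the $q$-shift operator in $x$, $T_x^{\pm1}g(x)=g(q^{\pm1}x)$, acting on the variable $x$ only (similarly $T_s^{\pm 1}$). With fixed nonzero complex parameters $t_1,\dots,t_4$ (the same for both operators), the operator $A^{\langle 2\rangle}$ is \begin{gather*} A^{\langle 2 \rangle} ( x; h_1, h_2, h_3, h_4, l_1, l_2, l_3, l_4 , \alpha ) = x^{-2} \prod_{n=1}^4 (x- q^{h_n +1/2} t_n) T_{x}^{-1} + q^{2\alpha +1} x^{-2} \prod_{n=1}^4 (x- q^{l_n -1/2} t_n) T_{x} \\ {} + q^{\alpha +1/2} \Big[ -(q^{1/2} +q^{-1/2} ) x^2 + \sum _{n=1}^4 (q^{h_n}+ q^{l_n} ) t_n x \\ {} + \Big(\prod_{n=1}^4 q^{(h_n +l_n)/2} t_n\Big) \Big\{ - (q^{1/2} +q^{-1/2} ) x^{-2} + \sum _{n=1}^4 \Big( \frac{1}{q^{h_n}t_n} + \frac{1}{q^{l_n}t_n} \Big) x^{-1} \Big\} \Big] . \end{gather*} $A^{\langle 2 \rangle}(s;\dots)$ is the same operator with $x$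 replaced by $s$ and $T_x$ by $T_s$. *)

theory Defs
  imports "HOL-Analysis.Complex_Transcendental"
begin

text \<open>
  Throughout, \<open>q\<close> is the base and \<open>lq\<close> is a fixed choice of \<open>log q\<close>, that is \<open>exp lq = q\<close>.
\<close>

definition qpow :: "complex \<Rightarrow> complex \<Rightarrow> complex" where
  "qpow lq a = exp (a * lq)"

text \<open>
  The power functions \<open>x\<^sup>a\<close> are taken with respect to a branch of the logarithm that is compatible
  with the \<open>q\<close>-shift, which is what makes \<open>(q x)\<^sup>a = q\<^sup>a x\<^sup>a\<close> hold.  The principal branch does not
  have this property.  No continuity is required.  Every branch on a \<open>q\<close>-invariant set that is
  compatible with the \<open>q\<close>-shift extends to one on all of \<open>\<complex> - {0}\<close>, orbit by orbit.
\<close>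

definition q_log_branch :: "complex \<Rightarrow> complex \<Rightarrow> (complex \<Rightarrow> complex) \<Rightarrow> bool" where
  "q_log_branch q lq L \<longleftrightarrow> (\<forall>x. x \<noteq> 0 \<longrightarrow> exp (L x) = x \<and> L (q * x) = L x + lq)"

definition cpow :: "(complex \<Rightarrow> complex) \<Rightarrow> complex \<Rightarrow> complex \<Rightarrow> complex" where
  "cpow L x a = exp (a * L x)"

lemma cpow_shift:
  assumes "q_log_branch q lq L" and "x \<noteq> 0"
  shows "cpow L (q * x) a = qpow lq a * cpow L x a"
  using assms by (simp add: q_log_branch_def cpow_def qpow_def ring_distribs exp_add)

lemma cpow_shift_inverse:
  assumes "q_log_branch q lq L" and "x \<noteq> 0" and "q \<noteq> 0"
  shows "cpow L (x / q) a = qpow lq (- a) * cpow L x a"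
proof -
  have "L (q * (x / q)) = L (x / q) + lq"
    using assms unfolding q_log_branch_def by (metis divide_eq_0_iff)
  then have "L x = L (x / q) + lq" using assms(3) by simp
  then show ?thesis by (simp add: cpow_def qpow_def ring_distribs flip: exp_add)
qed

lemma q_log_branch_exists:
  assumes "exp lq = q" and "norm q < 1"
  shows "\<exists>L. q_log_branch q lq L"
proof -
  define k where "k x = \<lfloor>ln (norm x) / Re lq\<rfloor>" for x :: complex
  define L where "L x = Ln (x / q powi k x) + of_int (k x) * lq" for x
  have q0: "q \<noteq> 0" using assms(1) by auto
  have R: "ln (norm q) = Re lq" using assms(1) by (metis ln_exp norm_exp_eq_Re)
  have R0: "Re lq \<noteq> 0" using assms by (metis less_irrefl norm_exp_eq_Re exp_zero)
  have e: "exp (of_int n * lq) = q powi n" for n :: int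
    using assms(1) exp_power_int[of lq n] by simp
  have "exp (L x) = x \<and> L (q * x) = L x + lq" if x: "x \<noteq> 0" for x
  proof -
    have "ln (norm (q * x)) / Re lq = ln (norm x) / Re lq + 1"
      using q0 x R0 R by (simp add: norm_mult ln_mult field_simps)
    then have k: "k (q * x) = k x + 1" unfolding k_def by simp
    have "q * x / q powi (k x + 1) = x / q powi k x"
      using q0 by (simp add: power_int_add)
    then have "L (q * x) = L x + lq" unfolding L_def k by (simp add: ring_distribs)
    moreover have "exp (L x) = x"
      unfolding L_def exp_add e using q0 x by simp
    ultimately show ?thesis by simp
  qed
  then show ?thesis unfolding q_log_branch_def by blast
qed

text \<open>The \<open>q\<close>-shift operators; \<open>qshift_inv\<close> is \<open>T\<^sup>-\<^sup>1\<close>.\<close>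

definition qshift :: "complex \<Rightarrow> (complex \<Rightarrow> complex) \<Rightarrow> complex \<Rightarrow> complex" where
  "qshift q g = (\<lambda>x. g (q * x))"

definition qshift_inv :: "complex \<Rightarrow> (complex \<Rightarrow> complex) \<Rightarrow> complex \<Rightarrow> complex" where
  "qshift_inv q g = (\<lambda>x. g (x / q))"

text \<open>
  Families of parameters are functions on \<open>nat\<close> of which only the values at \<open>1, \<dots>, 4\<close> matter.
\<close>

definition A2 ::
  "complex \<Rightarrow> complex \<Rightarrow> (nat \<Rightarrow> complex) \<Rightarrow> (nat \<Rightarrow> complex) \<Rightarrow> (nat \<Rightarrow> complex) \<Rightarrow> complex
    \<Rightarrow> (complex \<Rightarrow> complex) \<Rightarrow> complex \<Rightarrow> complex" where
  "A2 q lq t h l \<alpha> g = (\<lambda>x.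
      1 / x^2 * (\<Prod>n = 1..4. x - qpow lq (h n + 1/2) * t n) * qshift_inv q g x
    + qpow lq (2 * \<alpha> + 1) * (1 / x^2) * (\<Prod>n = 1..4. x - qpow lq (l n - 1/2) * t n) * qshift q g x
    + qpow lq (\<alpha> + 1/2) *
        (- (qpow lq (1/2) + qpow lq (- 1/2)) * x^2
         + (\<Sum>n = 1..4. (qpow lq (h n) + qpow lq (l n)) * t n) * x
         + (\<Prod>n = 1..4. qpow lq ((h n + l n) / 2) * t n) *
             (- (qpow lq (1/2) + qpow lq (- 1/2)) * (1 / x^2)
              + (\<Sum>n = 1..4. 1 / (qpow lq (h n) * t n) + 1 / (qpow lq (l n) * t n)) * (1 / x)))
      * g x)"

end

theory Submission
  imports Defs
begin

text \<open>
  Each side of the identity is the function acted on, times a rational function of \<open>x\<close> and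
  \<open>s\<close>: the shifts of the powers produce constants, and the shifts of \<open>P\<close> produce the two
  quotients in its functional equations.  Write \<open>M = q\<^sup>\<mu>\<^sup>0\<close>, \<open>C = q\<^sup>\<chi>\<close>, \<open>r = q\<^bsup>1/2\<^esup>\<close>,
  \<open>a\<^sub>n = q\<^bsup>h'\<^sub>n\<^esup> t\<^sub>n\<close>, \<open>b\<^sub>n = q\<^bsup>l'\<^sub>n\<^esup> t\<^sub>n\<close> and, for a family \<open>p\<close>, consider the Laurent
  polynomial \<open>\<psi>\<^sub>p(z) = z\<^sup>-\<^sup>2 \<Prod>\<^sub>n (z - p\<^sub>n)\<close>.

  The four shift terms pair off across the two sides.  The \<open>T\<^sub>x\<^sup>-\<^sup>1\<close> term and the \<open>T\<^sub>s\<close> term share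
  the quotient with denominator \<open>x - q\<^sup>\<mu> s\<close>, and they involve \<open>\<psi>\<^sub>b\<close> at \<open>y = x/(rMC)\<close> and at
  \<open>z = rs\<close> with the same prefactor.  As \<open>x - q\<^sup>\<mu> s = rMC (y - z)\<close>, their difference contains the
  divided difference of \<open>\<psi>\<^sub>b\<close> at \<open>y, z\<close>, and the denominator cancels.  In the same way the \<open>T\<^sub>x\<close>
  and \<open>T\<^sub>s\<^sup>-\<^sup>1\<close> terms combine to a divided difference of \<open>\<psi>\<^sub>a\<close> at \<open>rx/M\<close> and \<open>s/r\<close>.  Divided
  differences do not see the constant term of \<open>\<psi>\<close>, which is the second elementary symmetric
  polynomial; this is why the multiplication part of \<open>A2\<close> involves only the first, third and
  fourth ones.  The Laurent polynomial in \<open>x\<close> and \<open>s\<close> that is left vanishes coefficient by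
  coefficient, by means of the balancing condition \<open>\<Prod>a\<^sub>n = C\<^sup>2 \<Prod>b\<^sub>n\<close>, which is the definition
  of \<open>\<chi>\<close> in multiplicative form.  Lemma \<open>kernel_identity\<close> carries this out, and
  \<open>A2_on_quasi_periodic\<close> reduces the operators to it.
\<close>

section \<open>Laurent polynomials with four zeros\<close>

definition laurent4 :: "(nat \<Rightarrow> complex) \<Rightarrow> complex \<Rightarrow> complex" where
  "laurent4 p z = (\<Prod>n = 1..4. z - p n) / z^2"

text \<open>
  The third elementary symmetric polynomial is written as \<open>(\<Prod> p) (\<Sum> 1/p)\<close>, the form in which it
  occurs in \<open>A2\<close>.
\<close>

lemma laurent4_divided_difference:
  assumes "\<And>n. n \<in> {1..4} \<Longrightarrow> p n \<noteq> 0" and "y \<noteq> 0" and "z \<noteq> 0"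
  shows "laurent4 p y - laurent4 p z =
    (y - z) * (y + z - (\<Sum>n = 1..4. p n)
      + (\<Prod>n = 1..4. p n) * (\<Sum>n = 1..4. 1 / p n) / (y * z)
      - (\<Prod>n = 1..4. p n) * (y + z) / (y * z)^2)"
proof -
  have I: "{1..4} = {1, 2, 3, 4::nat}" by auto
  have nz: "p 1 \<noteq> 0" "p 2 \<noteq> 0" "p 3 \<noteq> 0" "p 4 \<noteq> 0"
    using assms(1) by (auto simp: I)
  define e2 where "e2 = p 1 * p 2 + p 1 * p 3 + p 1 * p 4 + p 2 * p 3 + p 2 * p 4 + p 3 * p 4"
  define e3 where "e3 = (\<Prod>n = 1..4. p n) * (\<Sum>n = 1..4. 1 / p n)"
  have e3: "e3 = p 2 * p 3 * p 4 + p 1 * p 3 * p 4 + p 1 * p 2 * p 4 + p 1 * p 2 * p 3"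
    unfolding e3_def I using nz by (simp add: field_simps)
  have expand: "laurent4 p w =
      w^2 - (\<Sum>n = 1..4. p n) * w + e2 - e3 / w + (\<Prod>n = 1..4. p n) / w^2"
    if "w \<noteq> 0" for w
    unfolding laurent4_def e2_def e3 I using that
    by (simp add: field_simps power2_eq_square)
  show ?thesis
    unfolding expand[OF assms(2)] expand[OF assms(3)] e3_def[symmetric]
    using assms(2,3) by (simp add: field_simps power2_eq_square)
qed

lemma laurent4_scale:
  assumes "c \<noteq> 0"
  shows "laurent4 (\<lambda>n. c * p n) z = c^2 * laurent4 p (z / c)"
proof -
  have "(\<Prod>n = 1..4. z - c * p n) = (\<Prod>n = 1..4. c * (z / c - p n))"
    using assms by (simp add: right_diff_distrib)
  also have "\<dots> = c^4 * (\<Prod>n = 1..4. z / c - p n)"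
    by (simp add: prod.distrib)
  finally show ?thesis
    using assms by (simp add: laurent4_def power_divide eval_nat_numeral)
qed

section \<open>The operator in multiplicative parameters\<close>

text \<open>
  The multiplication part of \<open>A2\<close> in multiplicative parameters: \<open>a\<close> and \<open>b\<close> stand for \<open>q\<^sup>h t\<close> and
  \<open>q\<^sup>l t\<close>, and \<open>k\<close> for the square root of the product of all eight that the exponents \<open>(h + l)/2\<close> select.
\<close>

definition mult_part ::
  "complex \<Rightarrow> (nat \<Rightarrow> complex) \<Rightarrow> (nat \<Rightarrow> complex) \<Rightarrow> complex \<Rightarrow> complex \<Rightarrow> complex" where
  "mult_part r a b k x =
    - (r + 1 / r) * x^2 + ((\<Sum>n = 1..4. a n) + (\<Sum>n = 1..4. b n)) * x
    + k * (- (r + 1 / r) / x^2 + ((\<Sum>n = 1..4. 1 / a n) + (\<Sum>n = 1..4. 1 / b n)) / x)"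

lemma qpow_add: "qpow lq (a + b) = qpow lq a * qpow lq b"
  by (simp add: qpow_def ring_distribs exp_add)

lemma qpow_minus: "qpow lq (- a) = 1 / qpow lq a"
  by (simp add: qpow_def exp_minus field_simps)

lemma qpow_diff: "qpow lq (a - b) = qpow lq a / qpow lq b"
  by (simp add: qpow_def left_diff_distrib exp_diff)

lemma qpow_nonzero [simp]: "qpow lq a \<noteq> 0"
  by (simp add: qpow_def)

lemma qpow_sum: "finite I \<Longrightarrow> qpow lq (sum f I) = (\<Prod>n\<in>I. qpow lq (f n))"
  by (simp add: qpow_def sum_distrib_right exp_sum)

lemma qpow_double: "qpow lq (2 * a) = (qpow lq a)^2"
  by (simp only: mult_2 qpow_add power2_eq_square)

lemma qpow_half_squared: "exp lq = q \<Longrightarrow> (qpow lq (1/2))^2 = q"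
  using qpow_double[of lq "1/2"] by (auto simp: qpow_def)

text \<open>
  On a function that the shifts multiply by constants, \<open>A2\<close> acts as multiplication.  The half
  powers of \<open>q\<close> in the zeros of the shift coefficients are absorbed in the argument of
  \<open>laurent4\<close>.
\<close>

lemma A2_on_quasi_periodic:
  fixes lq :: complex and t h l :: "nat \<Rightarrow> complex"
  defines "r \<equiv> qpow lq (1/2)"
    and "a \<equiv> \<lambda>n. qpow lq (h n) * t n" and "b \<equiv> \<lambda>n. qpow lq (l n) * t n"
  assumes down: "g (x / q) = u * g x" and up: "g (q * x) = v * g x"
  shows "A2 q lq t h l \<alpha> g x =
    (r^2 * laurent4 a (x / r) * u + (qpow lq \<alpha>)^2 * laurent4 b (r * x) * v
     + qpow lq \<alpha> * r * mult_part r a b (\<Prod>n = 1..4. qpow lq ((h n + l n) / 2) * t n) x) * g x"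
proof -
  have r0: "r \<noteq> 0" by (simp add: r_def)
  have "(\<Prod>n = 1..4. x - qpow lq (h n + 1/2) * t n) / x^2 = laurent4 (\<lambda>n. r * a n) x"
    by (simp add: laurent4_def a_def r_def qpow_add mult_ac)
  also have "\<dots> = r^2 * laurent4 a (x / r)"
    by (rule laurent4_scale[OF r0])
  finally have *: "(\<Prod>n = 1..4. x - qpow lq (h n + 1/2) * t n) / x^2 = r^2 * laurent4 a (x / r)" .
  have "(\<Prod>n = 1..4. x - qpow lq (l n - 1/2) * t n) / x^2 = laurent4 (\<lambda>n. (1 / r) * b n) x"
    by (simp add: laurent4_def b_def r_def qpow_diff mult_ac)
  also have "\<dots> = (1 / r)^2 * laurent4 b (r * x)"
    using laurent4_scale[of "1 / r" b x] r0 by (simp add: mult_ac)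
  finally have "r^2 * ((\<Prod>n = 1..4. x - qpow lq (l n - 1/2) * t n) / x^2) = laurent4 b (r * x)"
    using r0 by (simp add: power_divide)
  moreover have "qpow lq (2 * \<alpha> + 1) = (qpow lq \<alpha>)^2 * r^2"
    using qpow_double[of lq "1/2"] by (simp add: r_def qpow_add qpow_double)
  ultimately have **: "qpow lq (2 * \<alpha> + 1) * ((\<Prod>n = 1..4. x - qpow lq (l n - 1/2) * t n) / x^2)
      = (qpow lq \<alpha>)^2 * laurent4 b (r * x)"
    by (metis mult.assoc)
  have "A2 q lq t h l \<alpha> g x =
      (\<Prod>n = 1..4. x - qpow lq (h n + 1/2) * t n) / x^2 * (u * g x)
    + qpow lq (2 * \<alpha> + 1) * ((\<Prod>n = 1..4. x - qpow lq (l n - 1/2) * t n) / x^2) * (v * g x)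
    + qpow lq (\<alpha> + 1/2) *
        mult_part r a b (\<Prod>n = 1..4. qpow lq ((h n + l n) / 2) * t n) x * g x"
    by (simp add: A2_def mult_part_def qshift_def qshift_inv_def down up
        qpow_minus a_def b_def r_def sum.distrib ring_distribs)
  also have "\<dots> = r^2 * laurent4 a (x / r) * (u * g x)
    + (qpow lq \<alpha>)^2 * laurent4 b (r * x) * (v * g x)
    + qpow lq \<alpha> * r * mult_part r a b (\<Prod>n = 1..4. qpow lq ((h n + l n) / 2) * t n) x * g x"
    unfolding * ** by (simp add: qpow_add r_def)
  finally show ?thesis by (simp add: ring_distribs mult_ac)
qed

section \<open>The kernel identity\<close>

text \<open>
  The identity for the kernel in multiplicative parameters.  The common factor \<open>q\<^sup>\<alpha>\<close> is divided
  out, and the prefactor \<open>q\<^sup>\<nu>\<close> is spread over the terms of the right hand side.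
\<close>

lemma kernel_identity:
  fixes r M C x s :: complex and a b :: "nat \<Rightarrow> complex"
  defines "U \<equiv> (x - M * s) / (x - M * C * r^2 * s)"
    and "V \<equiv> (x - M * C * s) / (x - M / r^2 * s)"
  assumes nz: "r \<noteq> 0" "M \<noteq> 0" "C \<noteq> 0" "x \<noteq> 0" "s \<noteq> 0"
    and a0: "\<And>n. n \<in> {1..4} \<Longrightarrow> a n \<noteq> 0" and b0: "\<And>n. n \<in> {1..4} \<Longrightarrow> b n \<noteq> 0"
    and balance: "(\<Prod>n = 1..4. a n) = C^2 * (\<Prod>n = 1..4. b n)"
    and den: "x - M * C * r^2 * s \<noteq> 0" "x - M / r^2 * s \<noteq> 0"
  shows "r^2 * laurent4 (\<lambda>n. M * C * b n) (x / r) * U + laurent4 (\<lambda>n. M * a n) (r * x) * V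
      + r * mult_part r (\<lambda>n. M * C * b n) (\<lambda>n. M * a n) (M^4 * C^3 * (\<Prod>n = 1..4. b n)) x
    = M^2 * laurent4 a (s / r) * V + M^2 * C^2 * r^2 * laurent4 b (r * s) * U
      + M^2 * C * r * mult_part r a b (C * (\<Prod>n = 1..4. b n)) s"
proof -
  define y z where "y = x / (r * M * C)" and "z = r * s"
  define u w where "u = r * x / M" and "w = s / r"
  have nz': "y \<noteq> 0" "z \<noteq> 0" "u \<noteq> 0" "w \<noteq> 0"
    using nz by (auto simp: y_def z_def u_def w_def)
  define A B where "A = (\<Prod>n = 1..4. a n)" and "B = (\<Prod>n = 1..4. b n)"
  define a1 b1 where "a1 = (\<Sum>n = 1..4. a n)" and "b1 = (\<Sum>n = 1..4. b n)"
  define a3 b3 where "a3 = (\<Sum>n = 1..4. 1 / a n)" and "b3 = (\<Sum>n = 1..4. 1 / b n)"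
  define da db where "da = u + w - a1 + A * a3 / (u * w) - A * (u + w) / (u * w)^2"
    and "db = y + z - b1 + B * b3 / (y * z) - B * (y + z) / (y * z)^2"
  have ddb: "laurent4 b y - laurent4 b z = (y - z) * db"
    unfolding db_def b1_def b3_def B_def using b0 nz'(1,2)
    by (rule laurent4_divided_difference)
  have dda: "laurent4 a u - laurent4 a w = (u - w) * da"
    unfolding da_def a1_def a3_def A_def using a0 nz'(3,4)
    by (rule laurent4_divided_difference)
  \<comment> \<open>The denominators are proportional to \<open>y - z\<close> and \<open>u - w\<close>, and so they cancel.\<close>
  have U_den: "x - M * C * r^2 * s = r * M * C * (y - z)"
    using nz by (simp add: y_def z_def field_simps power2_eq_square)
  then have "y - z \<noteq> 0" using den(1) by auto
  then have Ub: "U * (y - z) = (x - M * s) / (r * M * C)"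
    unfolding U_def U_den by simp
  have V_den: "x - M / r^2 * s = M / r * (u - w)"
    using nz by (simp add: u_def w_def field_simps power2_eq_square)
  then have "u - w \<noteq> 0" using den(2) by auto
  then have Va: "V * (u - w) = r * (x - M * C * s) / M"
    unfolding V_def V_den by simp
  have lb: "laurent4 (\<lambda>n. M * C * b n) (x / r) = M^2 * C^2 * laurent4 b y"
    using laurent4_scale[of "M * C" b "x / r"] nz by (simp add: y_def power_mult_distrib mult_ac)
  have la: "laurent4 (\<lambda>n. M * a n) (r * x) = M^2 * laurent4 a u"
    using laurent4_scale[of M a "r * x"] nz by (simp add: u_def)
  have sums: "(\<Sum>n = 1..4. M * C * b n) = M * C * b1" "(\<Sum>n = 1..4. M * a n) = M * a1"
      "(\<Sum>n = 1..4. 1 / (M * C * b n)) = b3 / (M * C)" "(\<Sum>n = 1..4. 1 / (M * a n)) = a3 / M"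
    by (simp_all add: a1_def b1_def a3_def b3_def sum_distrib_left sum_divide_distrib mult_ac)
  have AB: "A = C^2 * B" using balance by (simp add: A_def B_def)
  \<comment> \<open>With the divided differences inserted, only a Laurent polynomial in \<open>x\<close> and \<open>s\<close> remains.\<close>
  have yz: "y * z = x * s / (M * C)" "r * M * C * (y + z) = x + M * C * r^2 * s"
    using nz by (simp_all add: y_def z_def field_simps power2_eq_square)
  have uw: "u * w = x * s / M" "r * M * (u + w) = r^2 * x + M * s"
    using nz by (simp_all add: u_def w_def field_simps power2_eq_square)
  have "r * M * C * db = r * M * C * (y + z) - r * M * C * b1 + r * M * C * B * b3 / (y * z)
      - B * (r * M * C * (y + z)) / (y * z)^2"
    by (simp add: db_def algebra_simps)
  then have db: "r * M * C * db = x + M * C * r^2 * s - r * M * C * b1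
      + r * M^2 * C^2 * B * b3 / (x * s) - M^2 * C^2 * B * (x + M * C * r^2 * s) / (x * s)^2"
    unfolding yz using nz by (simp add: power_divide power_mult_distrib power2_eq_square mult_ac)
  have "r * M * da = r * M * (u + w) - r * M * a1 + r * M * A * a3 / (u * w)
      - A * (r * M * (u + w)) / (u * w)^2"
    by (simp add: da_def algebra_simps)
  then have da: "r * M * da = r^2 * x + M * s - r * M * a1
      + r * M^2 * C^2 * B * a3 / (x * s) - M^2 * C^2 * B * (r^2 * x + M * s) / (x * s)^2"
    unfolding uw AB using nz
    by (simp add: power_divide power_mult_distrib power2_eq_square mult_ac)
  have mx: "r * mult_part r (\<lambda>n. M * C * b n) (\<lambda>n. M * a n) (M^4 * C^3 * B) x
      = - (r^2 + 1) * x^2 + r * M * (C * b1 + a1) * x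
        - M^4 * C^3 * B * (r^2 + 1) / x^2 + r * M^3 * C^2 * B * (b3 + C * a3) / x"
    unfolding mult_part_def sums using nz(1-3)
    by (simp add: add_divide_distrib diff_divide_distrib algebra_simps eval_nat_numeral)
  have ms: "r * mult_part r a b (C * B) s
      = - (r^2 + 1) * s^2 + r * (a1 + b1) * s - C * B * (r^2 + 1) / s^2 + r * C * B * (a3 + b3) / s"
    unfolding mult_part_def a1_def[symmetric] b1_def[symmetric] a3_def[symmetric] b3_def[symmetric]
    using nz(1) by (simp add: add_divide_distrib diff_divide_distrib algebra_simps power2_eq_square)
  have "(x - M * s) * (r * M * C * db) + (x - M * C * s) * (r * M * da)
      + r * mult_part r (\<lambda>n. M * C * b n) (\<lambda>n. M * a n) (M^4 * C^3 * B) x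
      = M^2 * C * (r * mult_part r a b (C * B) s)"
    unfolding db da mx ms using nz(4,5)
    by (simp add: divide_simps) (simp add: algebra_simps eval_nat_numeral)
  then have rest: "r^2 * M^2 * C^2 * ((x - M * s) / (r * M * C)) * db
      + M^2 * (r * (x - M * C * s) / M) * da
      + r * mult_part r (\<lambda>n. M * C * b n) (\<lambda>n. M * a n) (M^4 * C^3 * B) x
      = M^2 * C * r * mult_part r a b (C * B) s"
    using nz(1-3) by (simp add: power2_eq_square mult_ac)
  have "r^2 * (M^2 * C^2 * laurent4 b y) * U + M^2 * laurent4 a u * V
      = M^2 * laurent4 a w * V + M^2 * C^2 * r^2 * laurent4 b z * U
        + r^2 * M^2 * C^2 * U * (laurent4 b y - laurent4 b z)
        + M^2 * V * (laurent4 a u - laurent4 a w)"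
    by (simp add: algebra_simps)
  also have "\<dots> = M^2 * laurent4 a w * V + M^2 * C^2 * r^2 * laurent4 b z * U
        + r^2 * M^2 * C^2 * (U * (y - z)) * db + M^2 * (V * (u - w)) * da"
    unfolding ddb dda by (simp add: mult_ac)
  finally have "r^2 * (M^2 * C^2 * laurent4 b y) * U + M^2 * laurent4 a u * V
      + r * mult_part r (\<lambda>n. M * C * b n) (\<lambda>n. M * a n) (M^4 * C^3 * B) x
      = M^2 * laurent4 a w * V + M^2 * C^2 * r^2 * laurent4 b z * U
        + M^2 * C * r * mult_part r a b (C * B) s"
    unfolding Ub Va using rest by (simp only: add.assoc)
  then show ?thesis
    unfolding lb la B_def z_def w_def .
qed

theorem theorem2p3:
  fixes q lq :: complex
    and Lx Ls :: "complex \<Rightarrow> complex"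
    and t h l h' l' :: "nat \<Rightarrow> complex"
    and \<alpha> \<alpha>' \<mu>0 \<mu> chi \<nu> :: complex
    and P :: "complex \<Rightarrow> complex \<Rightarrow> complex"
    and D :: "(complex \<times> complex) set"
  assumes "0 < norm q" and "norm q < 1" and "exp lq = q"
    and "q_log_branch q lq Lx" and "q_log_branch q lq Ls"
    and "\<And>i. i \<in> {1..4} \<Longrightarrow> t i \<noteq> 0"
    and "chi = (h' 1 + h' 2 + h' 3 + h' 4 - l' 1 - l' 2 - l' 3 - l' 4) / 2"
    and "\<nu> = 2 * \<mu>0 + \<alpha> - \<alpha>' + chi"
    and "\<mu> = \<mu>0 + chi + 1"
    and "\<And>i. i \<in> {1..4} \<Longrightarrow> l i = h' i + \<mu>0"
    and "\<And>i. i \<in> {1..4} \<Longrightarrow> h i = l' i + \<mu>0 + chi"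
    \<comment> \<open>\<open>D\<close> is the domain of definition of \<open>P\<close>\<close>
    and "\<And>x s. \<lbrakk>x \<noteq> 0; s \<noteq> 0; (x, s) \<in> D; (x, s / q) \<in> D; (q * x, s) \<in> D;
            x - qpow lq (\<mu>0 - 1) * s \<noteq> 0\<rbrakk> \<Longrightarrow>
          P x (s / q) = P (q * x) s \<and>
          P (q * x) s = (x - qpow lq (\<mu> - 1) * s) / (x - qpow lq (\<mu>0 - 1) * s) * P x s"
    and "\<And>x s. \<lbrakk>x \<noteq> 0; s \<noteq> 0; (x, s) \<in> D; (x, q * s) \<in> D; (x / q, s) \<in> D;
            x - qpow lq \<mu> * s \<noteq> 0\<rbrakk> \<Longrightarrow>
          P x (q * s) = P (x / q) s \<and>
          P (x / q) s = (x - qpow lq \<mu>0 * s) / (x - qpow lq \<mu> * s) * P x s"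
  shows "\<forall>x s. x \<noteq> 0 \<longrightarrow> s \<noteq> 0 \<longrightarrow>
      {(x, s), (q * x, s), (x / q, s), (x, q * s), (x, s / q)} \<subseteq> D \<longrightarrow>
      x - qpow lq (\<mu>0 - 1) * s \<noteq> 0 \<longrightarrow> x - qpow lq \<mu> * s \<noteq> 0 \<longrightarrow>
      A2 q lq t h l \<alpha> (\<lambda>y. cpow Lx y (- \<alpha>) * cpow Ls s (chi + 1 - \<alpha>') * P y s) x
      = qpow lq \<nu> *
        A2 q lq t h' l' \<alpha>' (\<lambda>r. cpow Lx x (- \<alpha>) * cpow Ls r (chi + 1 - \<alpha>') * P x r) s"
proof (intro allI impI)
  fix x s :: complex
  assume x0: "x \<noteq> 0" and s0: "s \<noteq> 0"
    and dom: "{(x, s), (q * x, s), (x / q, s), (x, q * s), (x, s / q)} \<subseteq> D"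
    and den1: "x - qpow lq (\<mu>0 - 1) * s \<noteq> 0" and den2: "x - qpow lq \<mu> * s \<noteq> 0"
  define r M C where "r = qpow lq (1/2)" and "M = qpow lq \<mu>0" and "C = qpow lq chi"
  define E E' where "E = qpow lq \<alpha>" and "E' = qpow lq \<alpha>'"
  define a b where "a = (\<lambda>n. qpow lq (h' n) * t n)" and "b = (\<lambda>n. qpow lq (l' n) * t n)"
  define U V where "U = (x - M * s) / (x - M * C * r^2 * s)"
    and "V = (x - M * C * s) / (x - M / r^2 * s)"
  define f where "f = (\<lambda>y. cpow Lx y (- \<alpha>) * cpow Ls s (chi + 1 - \<alpha>') * P y s)"
  define g where "g = (\<lambda>w. cpow Lx x (- \<alpha>) * cpow Ls w (chi + 1 - \<alpha>') * P x w)"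
  have q0: "q \<noteq> 0" using assms(1) by auto
  have nz: "r \<noteq> 0" "M \<noteq> 0" "C \<noteq> 0" "E \<noteq> 0" "E' \<noteq> 0"
    by (simp_all add: r_def M_def C_def E_def E'_def)
  have q: "qpow lq 1 = q" using assms(3) by (simp add: qpow_def)
  have r2: "r^2 = q" unfolding r_def by (rule qpow_half_squared[OF assms(3)])
  have I: "{1..4} = {1, 2, 3, 4::nat}" by auto
  have mu: "qpow lq (\<mu>0 - 1) = M / r^2" "qpow lq \<mu> = M * C * r^2" "qpow lq (\<mu> - 1) = M * C"
    using q0 by (simp_all add: assms(9) qpow_add qpow_diff M_def C_def q r2)
  have P1: "P x (s / q) = V * P x s" "P (q * x) s = V * P x s"
    using assms(12)[OF x0 s0 _ _ _ den1] dom unfolding V_def M_def[symmetric] mu by auto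
  have P2: "P x (q * s) = U * P x s" "P (x / q) s = U * P x s"
    using assms(13)[OF x0 s0 _ _ _ den2] dom unfolding U_def M_def[symmetric] mu by auto
  have f: "f (x / q) = (E * U) * f x" "f (q * x) = (V / E) * f x"
    unfolding f_def P1 P2 cpow_shift[OF assms(4) x0] cpow_shift_inverse[OF assms(4) x0 q0]
    by (simp_all add: E_def qpow_minus)
  have g: "g (s / q) = (E' / (C * r^2) * V) * g s" "g (q * s) = (C * r^2 / E' * U) * g s"
    unfolding g_def P1 P2 cpow_shift[OF assms(5) s0] cpow_shift_inverse[OF assms(5) s0 q0]
    by (simp_all add: E'_def C_def qpow_minus qpow_add qpow_diff q r2)
  have hl: "qpow lq (h n) * t n = M * C * b n" "qpow lq (l n) * t n = M * a n"
    if "n \<in> {1..4}" for n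
    using assms(10,11)[OF that] by (simp_all add: a_def b_def M_def C_def qpow_add)
  have cong: "laurent4 (\<lambda>n. qpow lq (h n) * t n) = laurent4 (\<lambda>n. M * C * b n)"
      "laurent4 (\<lambda>n. qpow lq (l n) * t n) = laurent4 (\<lambda>n. M * a n)"
      "mult_part r (\<lambda>n. qpow lq (h n) * t n) (\<lambda>n. qpow lq (l n) * t n)
        = mult_part r (\<lambda>n. M * C * b n) (\<lambda>n. M * a n)"
    unfolding laurent4_def mult_part_def I by (simp_all add: hl fun_eq_iff)
  \<comment> \<open>The definition of \<open>chi\<close> determines the geometric means and the balancing condition.\<close>
  have chi: "(\<Sum>n = 1..4. h' n) = 2 * chi + (\<Sum>n = 1..4. l' n)"
    unfolding assms(7) I by (simp add: field_simps)
  have balance: "(\<Prod>n = 1..4. a n) = C^2 * (\<Prod>n = 1..4. b n)"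
    unfolding a_def b_def C_def prod.distrib
    by (simp add: chi qpow_add qpow_double del: One_nat_def flip: qpow_sum)
  have "(\<Sum>n = 1..4. (h' n + l' n) / 2) = chi + (\<Sum>n = 1..4. l' n)"
    using chi by (simp add: sum.distrib add_divide_distrib del: One_nat_def flip: sum_divide_distrib)
  then have mean': "(\<Prod>n = 1..4. qpow lq ((h' n + l' n) / 2) * t n) = C * (\<Prod>n = 1..4. b n)"
    unfolding b_def C_def prod.distrib by (simp add: qpow_add del: One_nat_def flip: qpow_sum)
  have half: "qpow lq ((h n + l n) / 2) * t n
      = M * qpow lq (chi / 2) * (qpow lq ((h' n + l' n) / 2) * t n)"
    if "n \<in> {1..4}" for n
  proof -
    have "(h n + l n) / 2 = \<mu>0 + chi / 2 + (h' n + l' n) / 2"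
      using assms(10,11)[OF that] by (simp add: field_simps)
    then show ?thesis by (simp only: qpow_add M_def mult_ac)
  qed
  have "(qpow lq (chi / 2))^2 = C"
    using qpow_double[of lq "chi / 2"] by (simp add: C_def)
  then have "(qpow lq (chi / 2))^4 = C^2"
    using power_mult[of "qpow lq (chi / 2)" 2 2] by simp
  moreover have "(\<Prod>n = 1..4. qpow lq ((h n + l n) / 2) * t n)
      = (\<Prod>n = 1..4. M * qpow lq (chi / 2) * (qpow lq ((h' n + l' n) / 2) * t n))"
    by (rule prod.cong[OF refl half])
  moreover have "\<dots> = (M * qpow lq (chi / 2))^4 * (C * (\<Prod>n = 1..4. b n))"
    unfolding prod.distrib[where h = "\<lambda>n. qpow lq ((h' n + l' n) / 2) * t n"] mean' by simp
  ultimately have mean: "(\<Prod>n = 1..4. qpow lq ((h n + l n) / 2) * t n)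
      = M^4 * C^3 * (\<Prod>n = 1..4. b n)"
    by (simp add: power_mult_distrib power2_eq_square power3_eq_cube)
  have nu: "qpow lq \<nu> = M^2 * C * E / E'"
    unfolding assms(8) by (simp add: qpow_add qpow_diff qpow_double M_def C_def E_def E'_def)
  have a0: "a n \<noteq> 0" and b0: "b n \<noteq> 0" if "n \<in> {1..4}" for n
    using assms(6)[OF that] by (simp_all add: a_def b_def)
  have id: "r^2 * laurent4 (\<lambda>n. M * C * b n) (x / r) * U + laurent4 (\<lambda>n. M * a n) (r * x) * V
      + r * mult_part r (\<lambda>n. M * C * b n) (\<lambda>n. M * a n) (M^4 * C^3 * (\<Prod>n = 1..4. b n)) x
    = M^2 * laurent4 a (s / r) * V + M^2 * C^2 * r^2 * laurent4 b (r * s) * U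
      + M^2 * C * r * mult_part r a b (C * (\<Prod>n = 1..4. b n)) s"
    unfolding U_def V_def using nz(1-3) x0 s0 a0 b0 balance den2 den1 unfolding mu
    by (rule kernel_identity)
  have "A2 q lq t h l \<alpha> f x =
      (r^2 * laurent4 (\<lambda>n. M * C * b n) (x / r) * (E * U)
       + E^2 * laurent4 (\<lambda>n. M * a n) (r * x) * (V / E)
       + E * r * mult_part r (\<lambda>n. M * C * b n) (\<lambda>n. M * a n)
           (M^4 * C^3 * (\<Prod>n = 1..4. b n)) x) * f x"
    using A2_on_quasi_periodic[where g = f, OF f, of lq t h l \<alpha>]
    unfolding r_def[symmetric] E_def[symmetric] cong mean .
  also have "\<dots> = E * (r^2 * laurent4 (\<lambda>n. M * C * b n) (x / r) * U
      + laurent4 (\<lambda>n. M * a n) (r * x) * V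
      + r * mult_part r (\<lambda>n. M * C * b n) (\<lambda>n. M * a n)
          (M^4 * C^3 * (\<Prod>n = 1..4. b n)) x) * f x"
    using nz by (simp add: field_simps power2_eq_square)
  also have "\<dots> = E * (M^2 * laurent4 a (s / r) * V + M^2 * C^2 * r^2 * laurent4 b (r * s) * U
      + M^2 * C * r * mult_part r a b (C * (\<Prod>n = 1..4. b n)) s) * g s"
    unfolding id by (simp add: f_def g_def)
  also have "\<dots> = qpow lq \<nu> * ((r^2 * laurent4 a (s / r) * (E' / (C * r^2) * V)
       + E'^2 * laurent4 b (r * s) * (C * r^2 / E' * U)
       + E' * r * mult_part r a b (C * (\<Prod>n = 1..4. b n)) s) * g s)"
    unfolding nu using nz by (simp add: field_simps power2_eq_square)
  also have "\<dots> = qpow lq \<nu> * A2 q lq t h' l' \<alpha>' g s"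
    using A2_on_quasi_periodic[where g = g, OF g, of lq t h' l' \<alpha>']
    unfolding r_def[symmetric] E'_def[symmetric] a_def[symmetric] b_def[symmetric] mean'
    by simp
  finally show "A2 q lq t h l \<alpha> (\<lambda>y. cpow Lx y (- \<alpha>) * cpow Ls s (chi + 1 - \<alpha>') * P y s) x
      = qpow lq \<nu> *
        A2 q lq t h' l' \<alpha>' (\<lambda>r. cpow Lx x (- \<alpha>) * cpow Ls r (chi + 1 - \<alpha>') * P x r) s"
    unfolding f_def g_def .
qed

end
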